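(* Let $1<p\le\infty$, $\alpha,\beta>0$ and $u\in \mathrm{BV}(\Omega)$. Then the infimum $$\inf_{w\in L^{p}(\Omega)} \alpha\|Du-w\|_{\mathcal M}+\beta\|w\|_{L^{p}(\Omega)}$$ is attained, i.e. there is a $w\in L^p(\Omega)$ at which it is a minimum.
   Context: $\Omega\subset\mathbb{R}^d$ is an open, bounded set with Lipschitz boundary. Functions $w\in L^p(\Omega)$ are understood as $\mathbb{R}^d$-valued, with $\|w\|_{L^p(\Omega)}$ the $L^p$ norm of the pointwise Euclidean norm $|w|$. $\mathrm{BV}(\Omega)$ is the space of $u\in L^1(\Omega)$ whose distributional derivative $Du$ is a finite $\mathbb{R}^d$-valued Radon measure. For an $\mathbb{R}^d$-valued distribution $\mathcal T$ on $\Omega$, the Radon norm is $\|\mathcal T\|_{\mathcal M}=\sup\{\langle \mathcal T,\phi\rangle:\phi\in C_c^\infty(\Omega,\mathbb{R}^d),\ \|\phi\|_\infty\le 1\}$, which equals $|\mu|(\Omega)$ if $\mathcal T$ is represented by a finite Radon measure $\mu$ and is $+\infty$ if $\mathcal{T}$ is not represented by such a measure. A function $w\in L^p(\Omega)$ is identified with the measure $w\,\mathcal L^d$. *)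

theory Defs
  imports "HOL-Analysis.Analysis" "HOL-Probability.Essential_Supremum"
begin

section \<open>Lipschitz domains\<close>

text \<open>Near each boundary point, \<open>\<Omega>\<close> is the strict epigraph of a Lipschitz function in some
  orthonormal coordinate system. The coordinate system enters only through its last axis \<open>e\<close>;
  the hyperplane orthogonal to \<open>e\<close> plays the role of \<open>R^(d-1)\<close>, and
  \<open>y - (y \<bullet> e) *\<^sub>R e\<close> is the projection of \<open>y\<close> onto it.\<close>

definition lipschitz_boundary :: "('a::euclidean_space) set \<Rightarrow> bool" where
  "lipschitz_boundary \<Omega> \<longleftrightarrow>
     (\<forall>x \<in> frontier \<Omega>. \<exists>r>0. \<exists>e \<gamma> L. norm e = 1 \<and> L-lipschitz_on {z. z \<bullet> e = 0} (\<gamma> :: 'a \<Rightarrow> real) \<and>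
        \<Omega> \<inter> ball x r = {y \<in> ball x r. \<gamma> (y - (y \<bullet> e) *\<^sub>R e) < y \<bullet> e})"

section \<open>Lebesgue spaces\<close>

text \<open>Elements are functions on the whole space of which only the restriction to \<open>\<Omega>\<close> matters;
  almost everywhere equal functions are not identified.\<close>

definition Lp :: "ennreal \<Rightarrow> 'a::euclidean_space set \<Rightarrow>
    ('a \<Rightarrow> 'b::{second_countable_topology, real_normed_vector}) set" where
  "Lp p \<Omega> = {w \<in> borel_measurable (lebesgue_on \<Omega>).
     if p = \<infinity> then esssup (lebesgue_on \<Omega>) (\<lambda>x. ennreal (norm (w x))) < \<infinity>
     else integrable (lebesgue_on \<Omega>) (\<lambda>x. norm (w x) powr enn2real p)}"

definition Lp_norm :: "ennreal \<Rightarrow> 'a::euclidean_space set \<Rightarrow>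
    ('a \<Rightarrow> 'b::{second_countable_topology, real_normed_vector}) \<Rightarrow> real" where
  "Lp_norm p \<Omega> w =
     (if p = \<infinity> then enn2real (esssup (lebesgue_on \<Omega>) (\<lambda>x. ennreal (norm (w x))))
      else (\<integral>x. norm (w x) powr enn2real p \<partial>lebesgue_on \<Omega>) powr (1 / enn2real p))"

section \<open>Test functions\<close>

definition partial_deriv :: "'d \<Rightarrow> (real^'d \<Rightarrow> 'b::real_normed_vector) \<Rightarrow> real^'d \<Rightarrow> 'b" where
  "partial_deriv i f x = frechet_derivative f (at x) (axis i 1)"

primrec Ck :: "nat \<Rightarrow> (real^'d \<Rightarrow> 'b::real_normed_vector) \<Rightarrow> bool" where
  "Ck 0 f \<longleftrightarrow> continuous_on UNIV f"
| "Ck (Suc k) f \<longleftrightarrow> (\<forall>x. f differentiable at x) \<and> (\<forall>i. Ck k (partial_deriv i f))"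

definition divergence :: "(real^'d \<Rightarrow> real^'d) \<Rightarrow> real^'d \<Rightarrow> real" where
  "divergence \<phi> x = (\<Sum>i\<in>UNIV. partial_deriv i \<phi> x $ i)"

text \<open>Compactly supported smooth functions on \<open>\<Omega>\<close> are represented by their extension by zero.\<close>

definition test_functions :: "(real^'d) set \<Rightarrow> (real^'d \<Rightarrow> 'b::real_normed_vector) set" where
  "test_functions \<Omega> = {\<phi>. (\<forall>k. Ck k \<phi>) \<and> compact (closure {x. \<phi> x \<noteq> 0}) \<and>
     closure {x. \<phi> x \<noteq> 0} \<subseteq> \<Omega>}"

section \<open>Vector-valued distributions\<close>

text \<open>An \<open>R^d\<close>-valued distribution is represented by the functional
  \<open>\<phi> \<mapsto> \<langle>T, \<phi>\<rangle>\<close>; only its values on \<open>test_functions \<Omega>\<close> matter.\<close>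

type_synonym 'd distribution = "(real^'d \<Rightarrow> real^'d) \<Rightarrow> real"

definition distr_grad :: "(real^'d) set \<Rightarrow> (real^'d \<Rightarrow> real) \<Rightarrow> 'd distribution" where
  "distr_grad \<Omega> u \<phi> = - (\<integral>x. u x * divergence \<phi> x \<partial>lebesgue_on \<Omega>)"

definition distr_of_fun :: "(real^'d) set \<Rightarrow> (real^'d \<Rightarrow> real^'d) \<Rightarrow> 'd distribution" where
  "distr_of_fun \<Omega> w \<phi> = (\<integral>x. w x \<bullet> \<phi> x \<partial>lebesgue_on \<Omega>)"

definition radon_norm :: "(real^'d) set \<Rightarrow> 'd distribution \<Rightarrow> ereal" where
  "radon_norm \<Omega> T = (SUP \<phi> \<in> {\<phi> \<in> test_functions \<Omega>. \<forall>x. norm (\<phi> x) \<le> 1}. ereal (T \<phi>))"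

section \<open>Vector measures and functions of bounded variation\<close>

text \<open>A countably additive set function with values in a finite-dimensional space is
  automatically finite, and on an open subset of Euclidean space finite Borel measures are
  Radon.\<close>

definition vector_measure :: "(real^'d) set \<Rightarrow> ((real^'d) set \<Rightarrow> real^'d) \<Rightarrow> bool" where
  "vector_measure \<Omega> \<mu> \<longleftrightarrow> \<mu> {} = 0 \<and>
     (\<forall>A. range A \<subseteq> sets (restrict_space borel \<Omega>) \<and> disjoint_family A \<longrightarrow>
        (\<lambda>n::nat. \<mu> (A n)) sums \<mu> (\<Union>n. A n))"

text \<open>The positive part in the Jordan decomposition of a finite signed measure \<open>\<nu>\<close> is
  \<open>A \<mapsto> sup {\<nu> B | B \<subseteq> A}\<close>; the negative part is the positive part of \<open>- \<nu>\<close>.\<close>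

definition jordan_pos :: "(real^'d) set \<Rightarrow> ((real^'d) set \<Rightarrow> real) \<Rightarrow> (real^'d) measure" where
  "jordan_pos \<Omega> \<nu> = measure_of \<Omega> (sets (restrict_space borel \<Omega>))
     (\<lambda>A. SUP B \<in> {B \<in> sets (restrict_space borel \<Omega>). B \<subseteq> A}. ennreal (\<nu> B))"

definition distr_of_measure :: "(real^'d) set \<Rightarrow> ((real^'d) set \<Rightarrow> real^'d) \<Rightarrow> 'd distribution" where
  "distr_of_measure \<Omega> \<mu> \<phi> =
     (\<Sum>i\<in>UNIV. (\<integral>x. \<phi> x $ i \<partial>jordan_pos \<Omega> (\<lambda>B. \<mu> B $ i)) -
               (\<integral>x. \<phi> x $ i \<partial>jordan_pos \<Omega> (\<lambda>B. - \<mu> B $ i)))"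

definition BV :: "(real^'d) set \<Rightarrow> (real^'d \<Rightarrow> real) set" where
  "BV \<Omega> = {u \<in> Lp 1 \<Omega>. \<exists>\<mu>. vector_measure \<Omega> \<mu> \<and>
     (\<forall>\<phi> \<in> test_functions \<Omega>. distr_grad \<Omega> u \<phi> = distr_of_measure \<Omega> \<mu> \<phi>)}"

end

theory Submission
  imports Defs
begin

text \<open>Weak compactness in \<open>L^p\<close> is replaced by a strict convexity argument that treats
  \<open>1 < p < \<infinity>\<close> and \<open>p = \<infinity>\<close> alike. If the infimum \<open>r\<close> is finite, the sublevel sets at level
  \<open>r + 1/(n+1)\<close> are nested, convex and bounded in \<open>L^q\<close> for some \<open>q > 1\<close>. Choose in each of them an
  almost-minimiser \<open>v n\<close> of the strictly convex integral \<open>v \<mapsto> \<integral> sqrt (1 + |v|^2)\<close>. For \<open>m \<ge> n\<close> the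
  midpoint of \<open>v n\<close> and \<open>v m\<close> lies in the \<open>n\<close>-th set, so the convexity gap of the pair is small,
  and the \<open>L^q\<close> bound turns this into smallness of \<open>\<integral> |v n - v m|\<close>. Along a subsequence \<open>v n\<close>
  converges in \<open>L^1\<close> and almost everywhere; the first mode of convergence passes to the limit in
  the pairing with test functions, the second one, by Fatou, in the \<open>L^p\<close> norm.\<close>

section \<open>Convergence in mean\<close>

text \<open>Fatou's lemma in Bochner form: almost everywhere \<open>h\<close> is the pointwise
  liminf of the \<open>g n\<close>, so its nonnegative integral is at most the limit of the bounds
  \<open>c n\<close>. As that limit is finite, \<open>h\<close> is integrable.\<close>

lemma integral_le_of_AE_tendsto:
  fixes g :: "nat \<Rightarrow> 'a \<Rightarrow> real"
  assumes int: "\<And>n. integrable M (g n)" and nonneg: "\<And>n x. 0 \<le> g n x"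
    and meas: "h \<in> borel_measurable M"
    and lim: "AE x in M. (\<lambda>n. g n x) \<longlonglongrightarrow> h x"
    and le: "\<And>n. (\<integral>x. g n x \<partial>M) \<le> c n" and c: "c \<longlonglongrightarrow> c0"
  shows "integrable M h" "(\<integral>x. h x \<partial>M) \<le> c0"
proof -
  have [measurable]: "g n \<in> borel_measurable M" for n using int by auto
  have h0: "AE x in M. 0 \<le> h x"
    using lim by eventually_elim (auto intro: LIMSEQ_le_const nonneg)
  have "(\<integral>\<^sup>+x. ennreal (h x) \<partial>M) = (\<integral>\<^sup>+x. liminf (\<lambda>n. ennreal (g n x)) \<partial>M)"
  proof (intro nn_integral_cong_AE, use lim in eventually_elim)
    fix x assume "(\<lambda>n. g n x) \<longlonglongrightarrow> h x"
    then have "(\<lambda>n. ennreal (g n x)) \<longlonglongrightarrow> ennreal (h x)" by (rule tendsto_ennrealI)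
    then show "ennreal (h x) = liminf (\<lambda>n. ennreal (g n x))"
      by (simp add: lim_imp_Liminf)
  qed
  also have "\<dots> \<le> liminf (\<lambda>n. \<integral>\<^sup>+x. ennreal (g n x) \<partial>M)"
    by (rule nn_integral_liminf) simp
  also have "\<dots> \<le> liminf (\<lambda>n. ennreal (c n))"
  proof (rule Liminf_mono, rule always_eventually, rule allI)
    fix n
    have "(\<integral>\<^sup>+x. ennreal (g n x) \<partial>M) = ennreal (\<integral>x. g n x \<partial>M)"
      by (rule nn_integral_eq_integral) (auto simp: int nonneg)
    then show "(\<integral>\<^sup>+x. ennreal (g n x) \<partial>M) \<le> ennreal (c n)"
      using le by (simp add: ennreal_leI)
  qed
  also have "\<dots> = ennreal c0"
    using c by (intro lim_imp_Liminf tendsto_ennrealI) auto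
  finally have fin: "(\<integral>\<^sup>+x. ennreal (h x) \<partial>M) \<le> ennreal c0" .
  show i: "integrable M h"
    using fin by (intro integrableI_nonneg meas h0) (auto simp: order_le_less_trans)
  \<comment> \<open>\<open>ennreal\<close> truncates negative reals to 0, so the sign of
    \<open>c0\<close> is needed before the bound can be read back in the reals.\<close>
  have "0 \<le> c n" for n
    using le[of n] Bochner_Integration.integral_nonneg[of M "g n"] nonneg by (meson order_trans)
  then have "0 \<le> c0" using c LIMSEQ_le_const by blast
  then show "(\<integral>x. h x \<partial>M) \<le> c0"
    using fin h0 i by (simp add: nn_integral_eq_integral)
qed

text \<open>Completeness of \<open>L^1\<close>, with almost everywhere convergence along a
  subsequence. The Cauchy condition is asked for ordered pairs of indices only, which is the form
  the selection argument below delivers.\<close>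

lemma L1_limit:
  fixes f :: "nat \<Rightarrow> 'a \<Rightarrow> 'b::{banach, second_countable_topology}"
  assumes int: "\<And>n. integrable M (f n)"
    and Cauchy: "\<And>e. e > 0 \<Longrightarrow> \<exists>N. \<forall>n\<ge>N. \<forall>m\<ge>n. (\<integral>x. norm (f n x - f m x) \<partial>M) < e"
  obtains r g where "strict_mono r" "integrable M g"
    "AE x in M. (\<lambda>n. f (r n) x) \<longlonglongrightarrow> g x"
    "(\<lambda>n. \<integral>x. norm (f (r n) x - g x) \<partial>M) \<longlonglongrightarrow> 0"
proof -
  have [measurable]: "f n \<in> borel_measurable M" for n using int by auto
  have C2: "\<exists>N. \<forall>i\<ge>N. \<forall>j\<ge>N. (\<integral>x. norm (f i x - f j x) \<partial>M) < e" if "e > 0" for e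
  proof -
    obtain N where N: "\<And>n m. n \<ge> N \<Longrightarrow> m \<ge> n \<Longrightarrow> (\<integral>x. norm (f n x - f m x) \<partial>M) < e"
      using Cauchy[OF \<open>e > 0\<close>] by blast
    have "(\<integral>x. norm (f i x - f j x) \<partial>M) < e" if "i \<ge> N" "j \<ge> N" for i j
      using N[of i j] N[of j i] that by (cases "i \<le> j") (simp_all add: norm_minus_commute)
    then show ?thesis by blast
  qed
  obtain r where r: "strict_mono r" and rC: "AE x in M. Cauchy (\<lambda>i. f (r i) x)"
    using cauchy_L1_AE_cauchy_subseq[OF int C2] by blast
  \<comment> \<open>Where the subsequence diverges \<open>lim\<close> is an unspecified value; such
    points form a null set.\<close>
  define g where "g x = lim (\<lambda>i. f (r i) x)" for x
  have gm[measurable]: "g \<in> borel_measurable M" unfolding g_def by measurable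
  have lim: "AE x in M. (\<lambda>i. f (r i) x) \<longlonglongrightarrow> g x"
    using rC by eventually_elim (simp add: g_def Cauchy_convergent_iff convergent_LIMSEQ_iff)
  \<comment> \<open>Fatou along the subsequence replaces \<open>f m\<close> by \<open>g\<close> in
    the Cauchy estimate. Shifting by \<open>i\<close> keeps every index used at least
    \<open>i\<close>.\<close>
  have close: "integrable M (\<lambda>x. norm (f i x - g x)) \<and> (\<integral>x. norm (f i x - g x) \<partial>M) \<le> e"
    if "\<And>m. m \<ge> i \<Longrightarrow> (\<integral>x. norm (f i x - f m x) \<partial>M) < e" for i e
  proof -
    define s where "s n = r (n + i)" for n
    have s: "s n \<ge> i" for n
      using seq_suble[OF r, of "n + i"] by (simp add: s_def)
    have "AE x in M. (\<lambda>n. norm (f i x - f (s n) x)) \<longlonglongrightarrow> norm (f i x - g x)"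
      using lim unfolding s_def
      by eventually_elim (intro tendsto_intros LIMSEQ_ignore_initial_segment)
    then show ?thesis
      using integral_le_of_AE_tendsto[of M "\<lambda>n x. norm (f i x - f (s n) x)"
          "\<lambda>x. norm (f i x - g x)" "\<lambda>_. e" e] that[OF s] int
      by (auto simp: less_imp_le)
  qed
  \<comment> \<open>One member at finite \<open>L^1\<close> distance from \<open>g\<close> suffices
    for integrability, as \<open>g\<close> is that member minus the difference.\<close>
  obtain N1 where N1: "\<And>m. m \<ge> N1 \<Longrightarrow> (\<integral>x. norm (f N1 x - f m x) \<partial>M) < 1"
    using Cauchy[of 1] by auto
  have "integrable M (\<lambda>x. f N1 x - g x)"
    using close[of N1 1, OF N1] by (subst integrable_norm_iff[symmetric]) auto
  then have "integrable M (\<lambda>x. f N1 x - (f N1 x - g x))"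
    by (rule Bochner_Integration.integrable_diff[OF int])
  then have gi: "integrable M g" by simp
  have "(\<lambda>n. \<integral>x. norm (f (r n) x - g x) \<partial>M) \<longlonglongrightarrow> 0"
  proof (rule LIMSEQ_I)
    fix e :: real assume "e > 0"
    then obtain N where N: "\<And>n m. n \<ge> N \<Longrightarrow> m \<ge> n \<Longrightarrow> (\<integral>x. norm (f n x - f m x) \<partial>M) < e/2"
      using Cauchy[of "e/2"] by auto
    have "(\<integral>x. norm (f (r n) x - g x) \<partial>M) \<le> e/2" if "n \<ge> N" for n
      using close[of "r n" "e/2"] N seq_suble[OF r, of n] that by (meson order_trans)
    then show "\<exists>N. \<forall>n\<ge>N. norm ((\<integral>x. norm (f (r n) x - g x) \<partial>M) - 0) < e"
      using \<open>e > 0\<close> by (intro exI[of _ N]) (fastforce simp: abs_of_nonneg)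
  qed
  with r gi lim show ?thesis using that by blast
qed

section \<open>Quantitative strict convexity of \<open>sqrt (1 + |a|^2)\<close>\<close>

text \<open>Lift \<open>a\<close> and \<open>b\<close> to (1, a) and (1, b). Then \<open>A\<close>
  and \<open>B\<close> are the norms of the lifts, \<open>P\<close> is their inner product and
  \<open>S\<close> the norm of their sum. The defect \<open>A * B - P\<close> in Cauchy-Schwarz
  bounds |a - b|^2 from above and is itself bounded by the defect \<open>A + B - S\<close> in the
  triangle inequality.\<close>

lemma sqrt_one_plus_norm_strictly_convex:
  fixes a b :: "'b::real_inner"
  assumes K: "K \<ge> 1" and a: "norm a \<le> K" and b: "norm b \<le> K"
  shows "(norm (a - b))\<^sup>2 \<le> 32 * K ^ 3 *
    (sqrt (1 + (norm a)\<^sup>2) + sqrt (1 + (norm b)\<^sup>2)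
      - 2 * sqrt (1 + (norm ((1/2) *\<^sub>R (a + b)))\<^sup>2))"
proof -
  define A where "A = sqrt (1 + (norm a)\<^sup>2)"
  define B where "B = sqrt (1 + (norm b)\<^sup>2)"
  define S where "S = 2 * sqrt (1 + (norm ((1/2) *\<^sub>R (a + b)))\<^sup>2)"
  define P where "P = 1 + a \<bullet> b"
  have A2: "A\<^sup>2 = 1 + a \<bullet> a" and B2: "B\<^sup>2 = 1 + b \<bullet> b"
    by (auto simp: A_def B_def power2_norm_eq_inner add_nonneg_nonneg)
  have A1: "A \<ge> 1" and B1: "B \<ge> 1" by (auto simp: A_def B_def)
  have S0: "S \<ge> 0" by (simp add: S_def)
  have "S\<^sup>2 = 4 * (1 + (norm ((1/2) *\<^sub>R (a + b)))\<^sup>2)"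
    unfolding S_def power_mult_distrib by (subst real_sqrt_pow2) auto
  then have S2: "S\<^sup>2 = 4 + a \<bullet> a + b \<bullet> b + 2 * (a \<bullet> b)"
    by (simp add: power_divide)
       (simp add: power2_norm_eq_inner inner_add_left inner_add_right inner_commute)
  have bound: "sqrt (1 + (norm z)\<^sup>2) \<le> 2 * K" if "norm z \<le> K" for z :: 'b
  proof (rule real_le_lsqrt)
    have "(norm z)\<^sup>2 \<le> K\<^sup>2" "1 \<le> K\<^sup>2" using that K by (auto intro: power_mono)
    then show "1 + (norm z)\<^sup>2 \<le> (2 * K)\<^sup>2" by (simp add: power_mult_distrib)
  qed (use K in auto)
  have AK: "A \<le> 2 * K" and BK: "B \<le> 2 * K" using bound a b by (auto simp: A_def B_def)
  have CS: "(a \<bullet> b)\<^sup>2 \<le> (a \<bullet> a) * (b \<bullet> b)" by (rule Cauchy_Schwarz_ineq)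
  have N2: "(norm (a - b))\<^sup>2 = a \<bullet> a + b \<bullet> b - 2 * (a \<bullet> b)"
    by (simp add: power2_norm_eq_inner inner_diff_left inner_diff_right inner_commute)
  \<comment> \<open>The right side minus the left side is the Gram determinant of \<open>a\<close>
    and \<open>b\<close>, which \<open>CS\<close> makes nonnegative.\<close>
  have Gram: "(norm (a - b))\<^sup>2 \<le> (A * B)\<^sup>2 - P\<^sup>2"
    using CS unfolding power_mult_distrib A2 B2 N2 P_def
    by (simp add: algebra_simps power2_eq_square)
  have PAB: "\<bar>P\<bar> \<le> A * B"
  proof (rule power2_le_imp_le)
    show "\<bar>P\<bar>\<^sup>2 \<le> (A * B)\<^sup>2" using order_trans[OF zero_le_power2 Gram] by simp
  qed (use A1 B1 in auto)
  have "(A * B)\<^sup>2 - P\<^sup>2 = (A * B - P) * (A * B + P)" by (simp add: algebra_simps power2_eq_square)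
  also have "\<dots> \<le> (A * B - P) * (2 * (A * B))" using PAB by (intro mult_left_mono) auto
  finally have 1: "(norm (a - b))\<^sup>2 \<le> (A * B - P) * (2 * (A * B))" using Gram by simp
  \<comment> \<open>Difference of squares, since S^2 = A^2 + B^2 + 2 P for the sum of the
    lifts.\<close>
  have eq: "2 * (A * B - P) = (A + B - S) * (A + B + S)"
  proof -
    have "(A + B - S) * (A + B + S) = A\<^sup>2 + B\<^sup>2 + 2 * A * B - S\<^sup>2"
      by (simp add: algebra_simps power2_eq_square)
    then show ?thesis by (simp add: A2 B2 S2 P_def)
  qed
  have pos: "A + B + S > 0" using A1 B1 S0 by linarith
  have SAB: "S \<le> A + B"
  proof (rule ccontr)
    assume "\<not> S \<le> A + B"
    then have "(A + B - S) * (A + B + S) < 0" using pos by (simp add: mult_neg_pos)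
    then show False using eq PAB by simp
  qed
  \<comment> \<open>\<open>S\<close> is at most \<open>A + B\<close>, so \<open>A + B + S\<close> is
    at most twice \<open>A + B\<close>, hence at most \<open>8 * K\<close>.\<close>
  have "2 * (A * B - P) \<le> (A + B - S) * (8 * K)"
    unfolding eq using SAB AK BK by (intro mult_left_mono) auto
  then have 2: "A * B - P \<le> (A + B - S) * (4 * K)" by simp
  have "A * B \<le> (2 * K) * (2 * K)" using AK BK A1 B1 K by (intro mult_mono) auto
  then have 3: "2 * (A * B) \<le> 8 * K\<^sup>2" by (simp add: power2_eq_square)
  have "(A * B - P) * (2 * (A * B)) \<le> ((A + B - S) * (4 * K)) * (8 * K\<^sup>2)"
    using PAB A1 B1 SAB K by (intro mult_mono 2 3) auto
  also have "\<dots> = 32 * K ^ 3 * (A + B - S)" by (simp add: power2_eq_square power3_eq_cube)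
  finally have "(norm (a - b))\<^sup>2 \<le> 32 * K ^ 3 * (A + B - S)" using 1 by linarith
  then show ?thesis by (simp only: A_def B_def S_def)
qed

text \<open>The middle term controls the region where both norms are at most \<open>K\<close>, the last one the
  region where one of them exceeds \<open>K\<close>.\<close>

lemma norm_diff_le_convexity_gap:
  fixes a b :: "'b::real_inner"
  assumes K: "K \<ge> 1" and q: "q > 1" and e: "e > 0"
  shows "norm (a - b) \<le> e + 32 * K ^ 3 / e *
    (sqrt (1 + (norm a)\<^sup>2) + sqrt (1 + (norm b)\<^sup>2)
      - 2 * sqrt (1 + (norm ((1/2) *\<^sub>R (a + b)))\<^sup>2))
    + 2 * K powr (1 - q) * (norm a powr q + norm b powr q)"
proof -
  define d where "d = sqrt (1 + (norm a)\<^sup>2) + sqrt (1 + (norm b)\<^sup>2)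
      - 2 * sqrt (1 + (norm ((1/2) *\<^sub>R (a + b)))\<^sup>2)"
  \<comment> \<open>The enlarged radius \<open>L\<close> covers both vectors, so that the previous
    lemma yields the sign of \<open>d\<close> in every case.\<close>
  define L where "L = max K (max (norm a) (norm b))"
  have L: "L \<ge> 1" "norm a \<le> L" "norm b \<le> L" using K by (auto simp: L_def)
  have "0 \<le> 32 * L ^ 3 * d"
    using sqrt_one_plus_norm_strictly_convex[OF L] unfolding d_def
    by (meson order_trans zero_le_power2)
  then have d0: "d \<ge> 0" using L by (simp add: zero_le_mult_iff)
  have c0: "0 \<le> 32 * K ^ 3 / e * d" using K e d0 by simp
  have t0: "0 \<le> 2 * K powr (1 - q) * (norm a powr q + norm b powr q)" by simp
  have "norm (a - b) \<le> e + 32 * K ^ 3 / e * d + 2 * K powr (1 - q) * (norm a powr q + norm b powr q)"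
  proof (cases "norm a \<le> K \<and> norm b \<le> K")
    case True
    have sq: "(norm (a - b))\<^sup>2 \<le> 32 * K ^ 3 * d"
      using sqrt_one_plus_norm_strictly_convex[OF K] True unfolding d_def by blast
    have "norm (a - b) \<le> e + 32 * K ^ 3 / e * d"
    \<comment> \<open>When |a - b| exceeds \<open>e\<close>, dividing its square by \<open>e\<close>
      gives a bound on |a - b| itself.\<close>
    proof (cases "norm (a - b) \<le> e")
      case True then show ?thesis using c0 by linarith
    next
      case False
      have "norm (a - b) * e \<le> norm (a - b) * norm (a - b)"
        using False by (intro mult_left_mono) auto
      then have "norm (a - b) * e \<le> 32 * K ^ 3 * d" using sq by (simp add: power2_eq_square)
      then have "norm (a - b) \<le> 32 * K ^ 3 * d / e" using e by (simp add: pos_le_divide_eq)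
      then show ?thesis using e by simp
    qed
    then show ?thesis using t0 by linarith
  next
    case False
    define m where "m = max (norm a) (norm b)"
    have mK: "m > K" using False by (auto simp: m_def)
    have m0: "m > 0" using mK K by linarith
    \<comment> \<open>The exponent \<open>1 - q\<close> is negative, so the first factor only grows
      when \<open>m\<close> is replaced by the smaller \<open>K\<close>.\<close>
    have "m = m powr (1 - q) * m powr q" using m0 by (simp flip: powr_add)
    also have "\<dots> \<le> K powr (1 - q) * m powr q"
      using mK K q by (intro mult_right_mono powr_mono2') auto
    also have "\<dots> \<le> K powr (1 - q) * (norm a powr q + norm b powr q)"
      by (intro mult_left_mono) (auto simp: m_def max_def)
    finally have "2 * m \<le> 2 * K powr (1 - q) * (norm a powr q + norm b powr q)" by simp
    moreover have "norm (a - b) \<le> 2 * m"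
      using norm_triangle_ineq4[of a b] by (simp add: m_def)
    ultimately show ?thesis using c0 e by linarith
  qed
  then show ?thesis by (simp add: d_def)
qed

section \<open>Almost-minimisers in nested convex sets\<close>

lemma le_one_plus_powr:
  fixes x :: real
  assumes "x \<ge> 0" "q \<ge> 1"
  shows "x \<le> 1 + x powr q"
proof (cases "x \<le> 1")
  case False
  then have "x powr 1 \<le> x powr q" using assms by (intro powr_mono) auto
  then show ?thesis using False by simp
qed (simp add: add_increasing2)

lemma integrable_of_powr_integrable:
  fixes v :: "'a \<Rightarrow> 'b::{banach, second_countable_topology}"
  assumes "finite_measure M" "q \<ge> 1" "v \<in> borel_measurable M"
    and "integrable M (\<lambda>x. norm (v x) powr q)"
  shows "integrable M v"
proof (rule Bochner_Integration.integrable_bound)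
  show "integrable M (\<lambda>x. 1 + norm (v x) powr q)"
    using assms by (intro Bochner_Integration.integrable_add finite_measure.integrable_const)
  show "AE x in M. norm (v x) \<le> norm (1 + norm (v x) powr q)"
    using le_one_plus_powr[of "norm (v _)" q] assms(2) by (auto intro!: AE_I2)
qed (use assms in auto)

text \<open>The infima \<open>j n\<close> of \<open>J\<close> over the shrinking sets increase to a
  finite limit, which forces the convexity gaps to 0. The limit \<open>w\<close> is not claimed to
  lie in any \<open>C n\<close>; that is left to lower semicontinuity in the application.\<close>

lemma L1_convergent_selection:
  fixes C :: "nat \<Rightarrow> ('a \<Rightarrow> 'b::euclidean_space) set"
  assumes fin: "finite_measure M" and q: "q > 1"
    and dec: "\<And>n m. n \<le> m \<Longrightarrow> C m \<subseteq> C n" and ne: "\<And>n. C n \<noteq> {}"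
    and meas: "\<And>v. v \<in> C 0 \<Longrightarrow> v \<in> borel_measurable M"
    and int: "\<And>v. v \<in> C 0 \<Longrightarrow> integrable M (\<lambda>x. norm (v x) powr q)"
    and bd: "\<And>v. v \<in> C 0 \<Longrightarrow> (\<integral>x. norm (v x) powr q \<partial>M) \<le> B"
    and mid: "\<And>n v w. v \<in> C n \<Longrightarrow> w \<in> C n \<Longrightarrow> (\<lambda>x. (1/2) *\<^sub>R (v x + w x)) \<in> C n"
  obtains v w where "\<And>n. v n \<in> C n" "integrable M w"
    "AE x in M. (\<lambda>n. v n x) \<longlonglongrightarrow> w x"
    "(\<lambda>n. \<integral>x. norm (v n x - w x) \<partial>M) \<longlonglongrightarrow> 0"
proof -
  interpret finite_measure M by (rule fin)
  define h where "h a = sqrt (1 + (norm a)\<^sup>2)" for a :: 'b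
  define J where "J v = (\<integral>x. h (v x) \<partial>M)" for v :: "'a \<Rightarrow> 'b"
  have h_bounds: "0 \<le> h a" "h a \<le> 1 + norm a" for a :: 'b
    unfolding h_def by (auto intro!: real_le_lsqrt simp: power2_eq_square algebra_simps)
  have hm[measurable]: "h \<in> borel_measurable borel" unfolding h_def by measurable
  have C0: "v \<in> C 0" if "v \<in> C n" for v n using dec[of 0 n] that by auto
  have iv: "integrable M v" if "v \<in> C 0" for v
    using integrable_of_powr_integrable[OF fin, of q v] q meas int that by auto
  have ih: "integrable M (\<lambda>x. h (v x))" if "v \<in> C 0" for v
  proof (rule Bochner_Integration.integrable_bound)
    show "integrable M (\<lambda>x. 1 + norm (v x))" using iv[OF that] by simp
    show "(\<lambda>x. h (v x)) \<in> borel_measurable M" using meas[OF that] by measurable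
  qed (use h_bounds in auto)
  have J0: "J v \<ge> 0" for v unfolding J_def using h_bounds by simp
  define mu where "mu = measure M (space M)"
  have Jle: "J v \<le> 2 * mu + B" if "v \<in> C 0" for v
  proof -
    have "J v \<le> (\<integral>x. 2 + norm (v x) powr q \<partial>M)"
      unfolding J_def
    proof (rule integral_mono[OF ih[OF that]])
      fix x show "h (v x) \<le> 2 + norm (v x) powr q"
        using h_bounds(2)[of "v x"] le_one_plus_powr[of "norm (v x)" q] q by simp
    qed (use int[OF that] in auto)
    also have "\<dots> \<le> 2 * mu + B" using int[OF that] bd[OF that] by (simp add: mu_def)
    finally show ?thesis .
  qed
  define j where "j n = Inf (J ` C n)" for n
  have bb: "bdd_below (J ` C n)" for n using J0 by (auto intro!: bdd_belowI2)
  have jle: "j n \<le> J v" if "v \<in> C n" for v n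
    unfolding j_def using that bb by (auto intro: cInf_lower)
  have jmono: "j n \<le> j m" if "n \<le> m" for n m
    unfolding j_def using dec[OF that] ne bb by (intro cInf_superset_mono) auto
  \<comment> \<open>Here the uniform bound on the q-th powers enters: it keeps the increasing
    sequence \<open>j\<close> from diverging.\<close>
  have "j n \<le> 2 * mu + B" for n
    using ne[of n] jle Jle C0 by (meson all_not_in_conv order_trans)
  then obtain l where l: "j \<longlonglongrightarrow> l"
    using incseq_convergent[of j "2 * mu + B"] jmono unfolding incseq_def by metis
  have jl: "j n \<le> l" for n using incseq_le[OF _ l] jmono by (auto simp: incseq_def)
  have "\<exists>v\<in>C n. J v < j n + 1 / real (Suc n)" for n
  proof -
    have "Inf (J ` C n) < j n + 1 / real (Suc n)" by (simp add: j_def)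
    then show ?thesis using cInf_lessD[of "J ` C n"] ne[of n] by blast
  qed
  then obtain v where vC: "\<And>n. v n \<in> C n" and vJ: "\<And>n. J (v n) < j n + 1 / real (Suc n)"
    by metis
  have v0: "v n \<in> C 0" for n using C0[OF vC] .
  define gap where "gap n m x = h (v n x) + h (v m x) - 2 * h ((1/2) *\<^sub>R (v n x + v m x))"
    for n m x
  have mid0: "(\<lambda>x. (1/2) *\<^sub>R (v n x + v m x)) \<in> C 0" for n m using mid v0 by blast
  have igap: "integrable M (gap n m)" for n m
    unfolding gap_def using ih[OF v0] ih[OF mid0] by auto
  \<comment> \<open>\<open>J (v n)\<close> exceeds \<open>j n\<close> by at most 1/(n+1),
    \<open>J (v m)\<close> exceeds \<open>l\<close> by at most the same amount, and the midpoint,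
    being in \<open>C n\<close>, contributes at least \<open>2 * j n\<close> to the subtracted
    term.\<close>
  have gap_le: "(\<integral>x. gap n m x \<partial>M) \<le> (l - j n) + 2 / real (Suc n)" if "n \<le> m" for n m
  proof -
    have "(\<integral>x. gap n m x \<partial>M) = J (v n) + J (v m) - 2 * J (\<lambda>x. (1/2) *\<^sub>R (v n x + v m x))"
      unfolding gap_def J_def using ih[OF v0] ih[OF mid0] by simp
    moreover have "v m \<in> C n" using vC[of m] dec[OF that] by auto
    then have "j n \<le> J (\<lambda>x. (1/2) *\<^sub>R (v n x + v m x))" using jle mid vC by blast
    moreover have "1 / real (Suc m) \<le> 1 / real (Suc n)" using that by (simp add: frac_le)
    moreover note vJ[of n] vJ[of m] jl[of m]
    ultimately show ?thesis by simp
  qed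
  have Cauchy: "\<exists>N. \<forall>n\<ge>N. \<forall>m\<ge>n. (\<integral>x. norm (v n x - v m x) \<partial>M) < e" if e: "e > 0" for e
  proof -
    have mu0: "mu \<ge> 0" by (simp add: mu_def)
    \<comment> \<open>Adding 1 to \<open>mu\<close> avoids division by 0 on a null space; over the
      whole space the constant \<open>e1\<close> integrates to less than e/2.\<close>
    define e1 where "e1 = e / (4 * (mu + 1))"
    have mu1: "mu + 1 \<noteq> 0" using mu0 by simp
    have "e1 > 0" using e mu0 by (simp add: e1_def)
    moreover have "e1 * mu < e/2"
    proof -
      have "e1 * (4 * (mu + 1)) = e" unfolding e1_def using mu1 by (intro nonzero_eq_divide_eq[THEN iffD1]) auto
      then show ?thesis using e \<open>e1 > 0\<close> by (simp add: algebra_simps)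
    qed
    ultimately have e1: "e1 > 0" "e1 * mu < e/2" by auto
    \<comment> \<open>The cutoff \<open>K\<close> is fixed first, making the contribution of large
      values small uniformly in the indices; only then is \<open>N\<close> chosen, depending on
      \<open>K\<close> through \<open>c\<close>.\<close>
    have "((\<lambda>K. 2 * K powr (1 - q) * (2 * B)) \<longlongrightarrow> 2 * 0 * (2 * B)) at_top"
      using q by (intro tendsto_intros tendsto_neg_powr filterlim_ident) auto
    then have "eventually (\<lambda>K. 2 * K powr (1 - q) * (2 * B) < e/4) at_top"
      using e by (intro order_tendstoD) auto
    then have "eventually (\<lambda>K::real. K \<ge> 1 \<and> 2 * K powr (1 - q) * (2 * B) < e/4) at_top"
      by (intro eventually_conj eventually_ge_at_top)
    then obtain K :: real where K: "K \<ge> 1" "2 * K powr (1 - q) * (2 * B) < e/4"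
      using eventually_happens'[OF trivial_limit_at_top_linorder] by blast
    define c where "c = 32 * K ^ 3 / e1"
    have c0: "c \<ge> 0" using K e1 by (simp add: c_def)
    have "(\<lambda>n. c * ((l - j n) + 2 / real (Suc n))) \<longlonglongrightarrow> c * ((l - l) + 0)"
      using l lim_const_over_n[of 2, THEN LIMSEQ_Suc] by (intro tendsto_intros) auto
    then have "eventually (\<lambda>n. c * ((l - j n) + 2 / real (Suc n)) < e/4) sequentially"
      using e by (intro order_tendstoD) auto
    then obtain N where N: "\<And>n. n \<ge> N \<Longrightarrow> c * ((l - j n) + 2 / real (Suc n)) < e/4"
      by (auto simp: eventually_sequentially)
    have "(\<integral>x. norm (v n x - v m x) \<partial>M) < e" if "n \<ge> N" "m \<ge> n" for n m
    proof -
      have "(\<integral>x. norm (v n x - v m x) \<partial>M) \<le>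
        (\<integral>x. e1 + c * gap n m x + 2 * K powr (1 - q) * (norm (v n x) powr q + norm (v m x) powr q) \<partial>M)"
      proof (rule integral_mono)
        fix x show "norm (v n x - v m x) \<le>
          e1 + c * gap n m x + 2 * K powr (1 - q) * (norm (v n x) powr q + norm (v m x) powr q)"
          unfolding c_def gap_def h_def by (rule norm_diff_le_convexity_gap[OF K(1) q e1(1)])
      qed (use iv[OF v0] igap int[OF v0] in auto)
      also have "\<dots> = e1 * mu + c * (\<integral>x. gap n m x \<partial>M) + 2 * K powr (1 - q) *
          ((\<integral>x. norm (v n x) powr q \<partial>M) + (\<integral>x. norm (v m x) powr q \<partial>M))"
        using igap int[OF v0] by (simp add: mu_def)
      also have "\<dots> \<le> e1 * mu + c * ((l - j n) + 2 / real (Suc n)) + 2 * K powr (1 - q) * (B + B)"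
        using c0 less_imp_le[OF e1(1)] gap_le[OF that(2)] bd[OF v0] by (intro add_mono mult_left_mono) auto
      also have "\<dots> < e/2 + e/4 + e/4" using e1(2) N[OF that(1)] K(2) by (intro add_strict_mono) auto
      finally show ?thesis by simp
    qed
    then show ?thesis by blast
  qed
  obtain r w where r: "strict_mono r" "integrable M w"
    "AE x in M. (\<lambda>n. v (r n) x) \<longlonglongrightarrow> w x"
    "(\<lambda>n. \<integral>x. norm (v (r n) x - w x) \<partial>M) \<longlonglongrightarrow> 0"
    using L1_limit[OF iv[OF v0] Cauchy] by blast
  \<comment> \<open>A strictly increasing \<open>r\<close> satisfies r n >= n, and the sets are
    nested.\<close>
  have "v (r n) \<in> C n" for n using vC[of "r n"] dec[OF seq_suble[OF r(1)]] by auto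
  then show ?thesis using r(2-4) by (rule that)
qed

section \<open>Lebesgue spaces on a domain\<close>

lemma powr_convex_combination:
  fixes x y t q :: real
  assumes q: "q \<ge> 1" and x: "x \<ge> 0" and y: "y \<ge> 0" and t: "0 \<le> t" "t \<le> 1"
  shows "((1 - t) * x + t * y) powr q \<le> (1 - t) * x powr q + t * y powr q"
proof -
  \<comment> \<open>If one argument is 0, the claim reduces to \<open>s powr q \<le> s\<close> on
    [0, 1]; convexity of the power is then invoked for positive arguments.\<close>
  have shrink: "(s * z) powr q \<le> s * z powr q" if "0 \<le> s" "s \<le> 1" "z \<ge> 0" for s z :: real
  proof -
    have "s powr q \<le> s"
    proof (cases "s = 0")
      case False
      then have "s powr q \<le> s powr 1" using that q by (intro powr_mono') auto
      then show ?thesis using that by simp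
    qed simp
    then have "s powr q * z powr q \<le> s * z powr q" by (intro mult_right_mono) auto
    then show ?thesis using that by (simp add: powr_mult)
  qed
  consider "x = 0" | "y = 0" | "x > 0" "y > 0" using x y by fastforce
  then show ?thesis
  proof cases
    case 1 then show ?thesis using shrink[of t y] t y by simp
  next
    case 2 then show ?thesis using shrink[of "1 - t" x] t x by simp
  next
    case 3 then show ?thesis
      using convex_onD[OF powr_convex[OF q], of t x y] t by simp
  qed
qed

text \<open>The radii \<open>s\<close> and \<open>t\<close> are upper bounds for the norms, so they
  can be taken positive and divided by. With weight \<open>\<theta>\<close> the sum is
  \<open>s + t\<close> times a convex combination of the normalised |f|/s and |g|/t, whose q-th
  powers have integral at most 1.\<close>

lemma Minkowski_powr:
  fixes f g :: "'a \<Rightarrow> 'b::{second_countable_topology, real_normed_vector}"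
  assumes q: "q \<ge> 1" and s: "s > 0" and t: "t > 0"
    and f: "f \<in> borel_measurable M" "integrable M (\<lambda>x. norm (f x) powr q)"
      "(\<integral>x. norm (f x) powr q \<partial>M) \<le> s powr q"
    and g: "g \<in> borel_measurable M" "integrable M (\<lambda>x. norm (g x) powr q)"
      "(\<integral>x. norm (g x) powr q \<partial>M) \<le> t powr q"
  shows "integrable M (\<lambda>x. norm (f x + g x) powr q)"
    and "(\<integral>x. norm (f x + g x) powr q \<partial>M) \<le> (s + t) powr q"
proof -
  note [measurable] = f(1) g(1)
  define \<theta> where "\<theta> = t / (s + t)"
  have th: "0 \<le> \<theta>" "\<theta> \<le> 1" using s t by (auto simp: \<theta>_def)
  define F where "F x = (s + t) powr q *
    ((1 - \<theta>) * (norm (f x) powr q / s powr q) + \<theta> * (norm (g x) powr q / t powr q))" for x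
  have iF: "integrable M F" unfolding F_def using f g by auto
  have le: "norm (f x + g x) powr q \<le> F x" for x
  proof -
    have eq: "norm (f x) + norm (g x) = (s + t) * ((1 - \<theta>) * (norm (f x) / s) + \<theta> * (norm (g x) / t))"
    proof -
      have "(s + t) * \<theta> = t" "(s + t) * (1 - \<theta>) = s"
        using s t by (simp_all add: \<theta>_def right_diff_distrib)
      then have "(s + t) * ((1 - \<theta>) * X + \<theta> * Y) = s * X + t * Y" for X Y
        by (simp only: distrib_left mult.assoc[symmetric])
      from this[of "norm (f x) / s" "norm (g x) / t"] show ?thesis using s t by simp
    qed
    have "norm (f x + g x) powr q \<le> (norm (f x) + norm (g x)) powr q"
      using q by (intro powr_mono2 norm_triangle_ineq) auto
    also have "\<dots> = (s + t) powr q * ((1 - \<theta>) * (norm (f x) / s) + \<theta> * (norm (g x) / t)) powr q"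
      unfolding eq by (rule powr_mult)
    also have "\<dots> \<le> (s + t) powr q *
        ((1 - \<theta>) * (norm (f x) / s) powr q + \<theta> * (norm (g x) / t) powr q)"
      using q s t th by (intro mult_left_mono powr_convex_combination) auto
    also have "\<dots> = F x" using s t by (simp add: F_def powr_divide)
    finally show ?thesis .
  qed
  show i: "integrable M (\<lambda>x. norm (f x + g x) powr q)"
    by (rule Bochner_Integration.integrable_bound[OF iF]) (auto intro!: AE_I2 order_trans[OF le])
  have "(\<integral>x. norm (f x + g x) powr q \<partial>M) \<le> (\<integral>x. F x \<partial>M)"
    by (rule integral_mono[OF i iF le])
  also have "\<dots> = (s + t) powr q * ((1 - \<theta>) * ((\<integral>x. norm (f x) powr q \<partial>M) / s powr q)
      + \<theta> * ((\<integral>x. norm (g x) powr q \<partial>M) / t powr q))"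
    unfolding F_def using f g by simp
  also have "\<dots> \<le> (s + t) powr q * ((1 - \<theta>) * 1 + \<theta> * 1)"
    using f(3) g(3) s t th by (intro mult_left_mono add_mono) auto
  finally show "(\<integral>x. norm (f x + g x) powr q \<partial>M) \<le> (s + t) powr q" by simp
qed

section \<open>Bounds, midpoints and limits in \<open>Lp\<close>\<close>

lemma Lp_borel_measurable: "w \<in> Lp p \<Omega> \<Longrightarrow> w \<in> borel_measurable (lebesgue_on \<Omega>)"
  by (simp add: Lp_def)

lemma Lp_norm_nonneg: "Lp_norm p \<Omega> w \<ge> 0"
  by (simp add: Lp_norm_def)

lemma Lp_zero: "(\<lambda>x. 0) \<in> Lp p \<Omega>"
proof -
  have "esssup (lebesgue_on \<Omega>) (\<lambda>x. ennreal (norm (0::'b))) \<le> 0"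
    by (intro esssup_I) auto
  then show ?thesis by (auto simp: Lp_def)
qed

lemma Lp_infinity_AE_le:
  assumes "w \<in> Lp \<infinity> \<Omega>"
  shows "AE x in lebesgue_on \<Omega>. norm (w x) \<le> Lp_norm \<infinity> \<Omega> w"
proof -
  \<comment> \<open>\<open>enn2real\<close> sends infinity to 0, so the comparison below is valid
    only because the essential supremum is finite.\<close>
  have fin: "esssup (lebesgue_on \<Omega>) (\<lambda>x. ennreal (norm (w x))) < top"
    using assms by (simp add: Lp_def)
  show ?thesis
    using esssup_AE[of "\<lambda>x. ennreal (norm (w x))" "lebesgue_on \<Omega>"]
  proof eventually_elim
    case (elim x)
    then have "enn2real (ennreal (norm (w x))) \<le> enn2real (esssup (lebesgue_on \<Omega>) (\<lambda>x. ennreal (norm (w x))))"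
      using fin by (intro enn2real_mono) auto
    then show ?case by (simp add: Lp_norm_def)
  qed
qed

lemma Lp_infinityI:
  assumes "w \<in> borel_measurable (lebesgue_on \<Omega>)" "AE x in lebesgue_on \<Omega>. norm (w x) \<le> c" "c \<ge> 0"
  shows "w \<in> Lp \<infinity> \<Omega>" "Lp_norm \<infinity> \<Omega> w \<le> c"
proof -
  have le: "esssup (lebesgue_on \<Omega>) (\<lambda>x. ennreal (norm (w x))) \<le> ennreal c"
    using assms by (intro esssup_I) (auto intro: ennreal_leI)
  then show "w \<in> Lp \<infinity> \<Omega>" using assms(1) by (auto simp: Lp_def order_le_less_trans)
  show "Lp_norm \<infinity> \<Omega> w \<le> c"
    using enn2real_mono[OF le] assms(3) by (simp add: Lp_norm_def)
qed

lemma finite_exponent_gt_one: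
  assumes p: "1 < p" "p \<noteq> \<infinity>" and q_def: "q = enn2real p"
  shows "q > 1"
proof (cases p)
  case (real r)
  with p have "ennreal 1 < ennreal r" by simp
  with real show ?thesis unfolding q_def by (simp only: ennreal_less_iff enn2real_ennreal)
qed (use p in simp)

lemma Lp_finiteI:
  assumes p: "1 < p" "p \<noteq> \<infinity>" and q_def: "q = enn2real p"
    and "w \<in> borel_measurable (lebesgue_on \<Omega>)" "integrable (lebesgue_on \<Omega>) (\<lambda>x. norm (w x) powr q)"
    and le: "(\<integral>x. norm (w x) powr q \<partial>lebesgue_on \<Omega>) \<le> c powr q" and c: "c \<ge> 0"
  shows "w \<in> Lp p \<Omega>" "Lp_norm p \<Omega> w \<le> c"
proof -
  show "w \<in> Lp p \<Omega>" using assms p by (simp add: Lp_def q_def)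
  have "(\<integral>x. norm (w x) powr q \<partial>lebesgue_on \<Omega>) powr (1/q) \<le> (c powr q) powr (1/q)"
    using finite_exponent_gt_one[OF p q_def] by (intro powr_mono2 le) auto
  also have "\<dots> = c" using finite_exponent_gt_one[OF p q_def] c by (simp add: powr_powr)
  finally show "Lp_norm p \<Omega> w \<le> c" using p by (simp add: Lp_norm_def q_def)
qed

lemma Lp_finiteD:
  assumes p: "1 < p" "p \<noteq> \<infinity>" and q_def: "q = enn2real p"
    and w: "w \<in> Lp p \<Omega>" and le: "Lp_norm p \<Omega> w \<le> c"
  shows "integrable (lebesgue_on \<Omega>) (\<lambda>x. norm (w x) powr q)"
    "(\<integral>x. norm (w x) powr q \<partial>lebesgue_on \<Omega>) \<le> c powr q"
proof -
  show "integrable (lebesgue_on \<Omega>) (\<lambda>x. norm (w x) powr q)"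
    using w p by (simp add: Lp_def q_def)
  have "(\<integral>x. norm (w x) powr q \<partial>lebesgue_on \<Omega>) = Lp_norm p \<Omega> w powr q"
    using finite_exponent_gt_one[OF p q_def] p by (simp add: Lp_norm_def powr_powr flip: q_def)
  also have "\<dots> \<le> c powr q"
    using le finite_exponent_gt_one[OF p q_def] by (intro powr_mono2) (auto simp: Lp_norm_nonneg)
  finally show "(\<integral>x. norm (w x) powr q \<partial>lebesgue_on \<Omega>) \<le> c powr q" .
qed

text \<open>Midpoint convexity is the form that \<open>L1_convergent_selection\<close> requires. It
  follows from the pointwise triangle inequality for p = \<open>\<infinity>\<close> and from
  Minkowski's inequality otherwise.\<close>

lemma Lp_midpoint:
  assumes p: "1 < p" and v: "v \<in> Lp p \<Omega>" and w: "w \<in> Lp p \<Omega>"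
  shows "(\<lambda>x. (1/2) *\<^sub>R (v x + w x)) \<in> Lp p \<Omega>"
    and "2 * Lp_norm p \<Omega> (\<lambda>x. (1/2) *\<^sub>R (v x + w x)) \<le> Lp_norm p \<Omega> v + Lp_norm p \<Omega> w"
proof -
  let ?z = "\<lambda>x. (1/2) *\<^sub>R (v x + w x)"
  note [measurable] = v[THEN Lp_borel_measurable] w[THEN Lp_borel_measurable]
  have zm: "?z \<in> borel_measurable (lebesgue_on \<Omega>)" by measurable
  \<comment> \<open>The slack \<open>e\<close> makes both radii positive, as \<open>Minkowski_powr\<close> requires.\<close>
  have *: "?z \<in> Lp p \<Omega> \<and> 2 * Lp_norm p \<Omega> ?z \<le> Lp_norm p \<Omega> v + Lp_norm p \<Omega> w + e"
    if e: "e > 0" for e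
  proof (cases "p = \<infinity>")
    case True
    have "AE x in lebesgue_on \<Omega>. norm (?z x) \<le> (Lp_norm \<infinity> \<Omega> v + Lp_norm \<infinity> \<Omega> w) / 2"
      using Lp_infinity_AE_le[OF v[unfolded True]] Lp_infinity_AE_le[OF w[unfolded True]]
    proof eventually_elim
      case (elim x)
      then show ?case using norm_triangle_ineq[of "v x" "w x"] by simp
    qed
    from Lp_infinityI[OF zm this] show ?thesis
      using e unfolding True by (simp add: Lp_norm_nonneg)
  next
    case False
    define q where "q = enn2real p"
    note fin = p False q_def
    have q1: "q > 1" using finite_exponent_gt_one[OF fin] .
    define s where "s = Lp_norm p \<Omega> v + e/2"
    define t where "t = Lp_norm p \<Omega> w + e/2"
    have st: "s > 0" "t > 0" using e by (auto simp: s_def t_def add_nonneg_pos Lp_norm_nonneg)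
    have vs: "Lp_norm p \<Omega> v \<le> s" and wt: "Lp_norm p \<Omega> w \<le> t" using e by (auto simp: s_def t_def)
    note M = Minkowski_powr[OF less_imp_le[OF q1] st Lp_borel_measurable[OF v] Lp_finiteD[OF fin v vs]
        Lp_borel_measurable[OF w] Lp_finiteD[OF fin w wt]]
    have nz: "norm (?z x) powr q = (1/2) powr q * norm (v x + w x) powr q" for x
      by (simp add: powr_mult powr_divide)
    have "(\<integral>x. norm (?z x) powr q \<partial>lebesgue_on \<Omega>) \<le> (1/2) powr q * (s + t) powr q"
      unfolding nz using M by simp
    also have "\<dots> = ((s + t) / 2) powr q" using st by (simp add: powr_divide)
    finally have "(\<integral>x. norm (?z x) powr q \<partial>lebesgue_on \<Omega>) \<le> ((s + t) / 2) powr q" .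
    moreover have "integrable (lebesgue_on \<Omega>) (\<lambda>x. norm (?z x) powr q)"
      unfolding nz using M by simp
    moreover have "0 \<le> (s + t) / 2" using st by simp
    ultimately have "?z \<in> Lp p \<Omega>" "Lp_norm p \<Omega> ?z \<le> (s + t) / 2"
      using Lp_finiteI[OF fin zm, of "(s + t) / 2"] by blast+
    then show ?thesis by (simp add: s_def t_def)
  qed
  show "?z \<in> Lp p \<Omega>" using *[of 1] by simp
  show "2 * Lp_norm p \<Omega> ?z \<le> Lp_norm p \<Omega> v + Lp_norm p \<Omega> w"
    by (rule field_le_epsilon) (rule conjunct2[OF *])
qed

text \<open>Fatou for the q-th powers when \<open>p\<close> is finite, a pointwise limit of bounds
  when it is not. Upper bounds \<open>c n\<close> stand in for the norms, whose own convergence is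
  not known.\<close>

lemma Lp_norm_lower_semicontinuous:
  fixes v :: "nat \<Rightarrow> 'a::euclidean_space \<Rightarrow> 'b::{second_countable_topology, real_normed_vector}"
  assumes p: "1 < p" and v: "\<And>n. v n \<in> Lp p \<Omega>" and w: "w \<in> borel_measurable (lebesgue_on \<Omega>)"
    and lim: "AE x in lebesgue_on \<Omega>. (\<lambda>n. v n x) \<longlonglongrightarrow> w x"
    and le: "\<And>n. Lp_norm p \<Omega> (v n) \<le> c n" and c: "c \<longlonglongrightarrow> c0"
  shows "w \<in> Lp p \<Omega>" "Lp_norm p \<Omega> w \<le> c0"
proof -
  have cn: "c n \<ge> 0" for n using Lp_norm_nonneg le order_trans by blast
  have c0: "c0 \<ge> 0" using c cn LIMSEQ_le_const by blast
  have "w \<in> Lp p \<Omega> \<and> Lp_norm p \<Omega> w \<le> c0"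
  proof (cases "p = \<infinity>")
    case True
    \<comment> \<open>Countably many null sets are merged into one, so that the limit can be taken
      at a fixed point.\<close>
    have "AE x in lebesgue_on \<Omega>. \<forall>n. norm (v n x) \<le> Lp_norm \<infinity> \<Omega> (v n)"
      using Lp_infinity_AE_le v True by (auto simp: AE_all_countable)
    then have "AE x in lebesgue_on \<Omega>. norm (w x) \<le> c0"
      using lim
    proof eventually_elim
      case (elim x)
      have "norm (v n x) \<le> c n" for n using elim(1) le[of n] True by (meson order_trans)
      then show ?case using tendsto_norm[OF elim(2)] c by (intro LIMSEQ_le) auto
    qed
    then show ?thesis using Lp_infinityI[OF w] c0 True by auto
  next
    case False
    define q where "q = enn2real p"
    note fin = p False q_def
    have q1: "q > 1" using finite_exponent_gt_one[OF fin] .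
    have "AE x in lebesgue_on \<Omega>. (\<lambda>n. norm (v n x) powr q) \<longlonglongrightarrow> norm (w x) powr q"
      using lim by eventually_elim (use q1 in \<open>intro tendsto_powr2 tendsto_intros; simp\<close>)
    moreover have "(\<lambda>n. c n powr q) \<longlonglongrightarrow> c0 powr q"
      using q1 cn c by (intro tendsto_powr2 tendsto_intros) auto
    ultimately have "integrable (lebesgue_on \<Omega>) (\<lambda>x. norm (w x) powr q)"
      "(\<integral>x. norm (w x) powr q \<partial>lebesgue_on \<Omega>) \<le> c0 powr q"
      using integral_le_of_AE_tendsto[of "lebesgue_on \<Omega>" "\<lambda>n x. norm (v n x) powr q"
          "\<lambda>x. norm (w x) powr q" "\<lambda>n. c n powr q" "c0 powr q"]
        Lp_finiteD[OF fin v le] w by auto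
    then show ?thesis using Lp_finiteI[OF fin w] c0 by blast
  qed
  then show "w \<in> Lp p \<Omega>" "Lp_norm p \<Omega> w \<le> c0" by auto
qed

text \<open>Supplies the exponent \<open>q\<close> and bound \<open>B\<close> for
  \<open>L1_convergent_selection\<close>. For p = \<open>\<infinity>\<close> the exponent 2 is used,
  finite measure turning a sup bound into an integral bound; otherwise \<open>q\<close> is
  \<open>p\<close> itself.\<close>

lemma Lp_superlinear_bound:
  fixes \<Omega> :: "'a::euclidean_space set"
  assumes p: "1 < p" and \<Omega>: "finite_measure (lebesgue_on \<Omega>)"
  obtains q B where "q > 1"
    "\<And>w :: 'a \<Rightarrow> 'b::{second_countable_topology, real_normed_vector}.
      w \<in> Lp p \<Omega> \<Longrightarrow> integrable (lebesgue_on \<Omega>) (\<lambda>x. norm (w x) powr q)"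
    "\<And>w :: 'a \<Rightarrow> 'b. w \<in> Lp p \<Omega> \<Longrightarrow> Lp_norm p \<Omega> w \<le> c \<Longrightarrow>
      (\<integral>x. norm (w x) powr q \<partial>lebesgue_on \<Omega>) \<le> B"
proof (cases "p = \<infinity>")
  case True
  have bound: "integrable (lebesgue_on \<Omega>) (\<lambda>x. norm (w x) powr 2) \<and>
      (\<integral>x. norm (w x) powr 2 \<partial>lebesgue_on \<Omega>) \<le> d powr 2 * measure (lebesgue_on \<Omega>) (space (lebesgue_on \<Omega>))"
    if w: "w \<in> Lp p \<Omega>" and d: "Lp_norm p \<Omega> w \<le> d" for w :: "'a \<Rightarrow> 'b" and d
  proof -
    note [measurable] = w[THEN Lp_borel_measurable]
    have AE: "AE x in lebesgue_on \<Omega>. norm (w x) powr 2 \<le> d powr 2"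
      using Lp_infinity_AE_le[OF w[unfolded True]]
    proof eventually_elim
      case (elim x)
      then show ?case using d unfolding True by (intro powr_mono2) auto
    qed
    have i: "integrable (lebesgue_on \<Omega>) (\<lambda>x. norm (w x) powr 2)"
      using AE by (intro finite_measure.integrable_const_bound[OF \<Omega>, where B="d powr 2"]) auto
    have "(\<integral>x. norm (w x) powr 2 \<partial>lebesgue_on \<Omega>) \<le> (\<integral>x. d powr 2 \<partial>lebesgue_on \<Omega>)"
      using AE i finite_measure.integrable_const[OF \<Omega>] by (intro integral_mono_AE) auto
    with i show ?thesis by (simp add: mult.commute)
  qed
  show ?thesis by (rule that[of 2]) (use bound in auto)
next
  case False
  define q where "q = enn2real p"
  note fin = p False q_def
  show ?thesis
    by (rule that[of q "c powr q"]) (use finite_exponent_gt_one[OF fin] Lp_finiteD[OF fin] in auto)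
qed

section \<open>Test functions and the Radon norm\<close>

lemma Ck_zero: "Ck k (\<lambda>x :: real^'d. 0 :: 'b::real_normed_vector)"
proof (induction k)
  case (Suc k)
  have "partial_deriv i (\<lambda>x :: real^'d. 0 :: 'b) = (\<lambda>x. 0)" for i
    by (simp add: partial_deriv_def fun_eq_iff)
  with Suc show ?case by simp
qed simp

lemma test_functions_zero: "(\<lambda>x. 0) \<in> test_functions \<Omega>"
  by (simp add: test_functions_def Ck_zero)

lemma test_functions_borel_measurable:
  fixes \<phi> :: "real^'d \<Rightarrow> 'b::real_normed_vector"
  assumes "\<phi> \<in> test_functions \<Omega>"
  shows "\<phi> \<in> borel_measurable (lebesgue_on S)"
proof -
  have "Ck 0 \<phi>" using assms by (simp only: test_functions_def mem_Collect_eq)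
  then have "\<phi> \<in> borel_measurable lborel" by (simp add: borel_measurable_continuous_onI)
  then have "\<phi> \<in> borel_measurable (completion lborel)" by (rule measurable_completion)
  then show ?thesis by (rule measurable_restrict_space1)
qed

lemma distr_grad_zero: "distr_grad \<Omega> u (\<lambda>x. 0) = 0"
  by (simp add: distr_grad_def divergence_def partial_deriv_def)

lemma distr_of_fun_zero: "distr_of_fun \<Omega> w (\<lambda>x. 0) = 0"
  by (simp add: distr_of_fun_def)

lemma pairing_bounded:
  fixes v \<phi> :: "'a \<Rightarrow> 'b::euclidean_space"
  assumes v: "integrable M v" and \<phi>: "\<phi> \<in> borel_measurable M" "\<And>x. norm (\<phi> x) \<le> 1"
  shows "integrable M (\<lambda>x. v x \<bullet> \<phi> x)"
    and "\<bar>\<integral>x. v x \<bullet> \<phi> x \<partial>M\<bar> \<le> (\<integral>x. norm (v x) \<partial>M)"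
proof -
  have le: "\<bar>v x \<bullet> \<phi> x\<bar> \<le> norm (v x)" for x
  proof -
    have "\<bar>v x \<bullet> \<phi> x\<bar> \<le> norm (v x) * norm (\<phi> x)" by (rule Cauchy_Schwarz_ineq2)
    also have "\<dots> \<le> norm (v x)" using \<phi>(2) by (intro mult_left_le) auto
    finally show ?thesis .
  qed
  note [measurable] = borel_measurable_integrable[OF v] \<phi>(1)
  show i: "integrable M (\<lambda>x. v x \<bullet> \<phi> x)"
    by (rule Bochner_Integration.integrable_bound[OF v]) (use le in auto)
  have "norm (\<integral>x. v x \<bullet> \<phi> x \<partial>M) \<le> (\<integral>x. norm (v x) \<partial>M)"
    using i v le by (intro order_trans[OF integral_norm_bound integral_mono]) auto
  then show "\<bar>\<integral>x. v x \<bullet> \<phi> x \<partial>M\<bar> \<le> (\<integral>x. norm (v x) \<partial>M)" by simp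
qed

lemma distr_of_fun_midpoint:
  assumes v: "integrable (lebesgue_on \<Omega>) v" and w: "integrable (lebesgue_on \<Omega>) w"
    and \<phi>: "\<phi> \<in> test_functions \<Omega>" "\<And>x. norm (\<phi> x) \<le> 1"
  shows "distr_of_fun \<Omega> (\<lambda>x. (1/2) *\<^sub>R (v x + w x)) \<phi> = (distr_of_fun \<Omega> v \<phi> + distr_of_fun \<Omega> w \<phi>) / 2"
proof -
  note pairing = pairing_bounded(1)[OF _ test_functions_borel_measurable[OF \<phi>(1)] \<phi>(2)]
  show ?thesis
    unfolding distr_of_fun_def using pairing[OF v] pairing[OF w] by (simp add: inner_add_left)
qed

text \<open>Against a test function bounded by 1, the pairings of two functions differ by at most
  their \<open>L^1\<close> distance.\<close>

lemma distr_of_fun_tendsto: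
  assumes v: "\<And>n. integrable (lebesgue_on \<Omega>) (v n)" and w: "integrable (lebesgue_on \<Omega>) w"
    and L1: "(\<lambda>n. \<integral>x. norm (v n x - w x) \<partial>lebesgue_on \<Omega>) \<longlonglongrightarrow> 0"
    and \<phi>: "\<phi> \<in> test_functions \<Omega>" "\<And>x. norm (\<phi> x) \<le> 1"
  shows "(\<lambda>n. distr_of_fun \<Omega> (v n) \<phi>) \<longlonglongrightarrow> distr_of_fun \<Omega> w \<phi>"
proof (rule LIM_zero_cancel, rule Lim_null_comparison[OF _ L1], rule always_eventually, rule allI)
  fix n
  note pairing = pairing_bounded[OF _ test_functions_borel_measurable[OF \<phi>(1)] \<phi>(2)]
  have "distr_of_fun \<Omega> (v n) \<phi> - distr_of_fun \<Omega> w \<phi> = (\<integral>x. (v n x - w x) \<bullet> \<phi> x \<partial>lebesgue_on \<Omega>)"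
    unfolding distr_of_fun_def using pairing(1)[OF v] pairing(1)[OF w] by (simp add: inner_diff_left)
  then show "norm (distr_of_fun \<Omega> (v n) \<phi> - distr_of_fun \<Omega> w \<phi>)
      \<le> (\<integral>x. norm (v n x - w x) \<partial>lebesgue_on \<Omega>)"
    using pairing(2)[OF Bochner_Integration.integrable_diff[OF v w]] by simp
qed

section \<open>Existence of a minimiser\<close>

text \<open>Convexity of the sublevel condition for one test function: \<open>g\<close> is the value
  of \<open>T\<close>, \<open>a\<close> and \<open>b\<close> are the pairings with two functions,
  \<open>x\<close> and \<open>y\<close> their norms, and \<open>z\<close> is the norm of their
  midpoint.\<close>

lemma midpoint_le:
  fixes a b c g x y z \<alpha> \<beta> :: real
  assumes a: "\<alpha> * (g - a) + \<beta> * x \<le> c" and b: "\<alpha> * (g - b) + \<beta> * y \<le> c"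
    and z: "2 * z \<le> x + y" and "\<beta> \<ge> 0"
  shows "\<alpha> * (g - (a + b) / 2) + \<beta> * z \<le> c"
proof -
  have "2 * (\<alpha> * (g - (a + b) / 2) + \<beta> * z) = \<alpha> * (g - a) + \<alpha> * (g - b) + \<beta> * (2 * z)"
    by (simp add: algebra_simps)
  also have "\<dots> \<le> \<alpha> * (g - a) + \<alpha> * (g - b) + \<beta> * (x + y)"
    using z \<open>\<beta> \<ge> 0\<close> by (intro add_left_mono mult_left_mono)
  also have "\<dots> \<le> 2 * c" using add_mono[OF a b] by (simp add: distrib_left)
  finally show ?thesis by simp
qed

text \<open>Replaces an inequality in \<open>ereal\<close> by one real inequality per test function,
  so that convexity and limits can be treated with the test function fixed.\<close>

lemma radon_norm_plus_le_iff:
  assumes "\<alpha> > 0"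
  shows "ereal \<alpha> * radon_norm \<Omega> T + ereal b \<le> ereal c \<longleftrightarrow>
    (\<forall>\<phi> \<in> test_functions \<Omega>. (\<forall>x. norm (\<phi> x) \<le> 1) \<longrightarrow> \<alpha> * T \<phi> + b \<le> c)"
proof -
  have "ereal \<alpha> * radon_norm \<Omega> T + ereal b \<le> ereal c \<longleftrightarrow> radon_norm \<Omega> T \<le> ereal ((c - b) / \<alpha>)"
    using assms by (cases "radon_norm \<Omega> T") (auto simp: field_simps)
  also have "\<dots> \<longleftrightarrow> (\<forall>\<phi> \<in> test_functions \<Omega>. (\<forall>x. norm (\<phi> x) \<le> 1) \<longrightarrow> T \<phi> \<le> (c - b) / \<alpha>)"
    by (auto simp: radon_norm_def SUP_le_iff)
  also have "\<dots> \<longleftrightarrow> (\<forall>\<phi> \<in> test_functions \<Omega>. (\<forall>x. norm (\<phi> x) \<le> 1) \<longrightarrow> \<alpha> * T \<phi> + b \<le> c)"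
    using assms by (simp add: field_simps)
  finally show ?thesis .
qed

text \<open>Since \<open>T\<close> vanishes at the zero function, testing with zero shows that the
  functional dominates \<open>\<beta> * Lp_norm p \<Omega> w\<close>. This gives both its
  nonnegativity and the norm bound on sublevel sets.\<close>

lemma radon_norm_Lp_minimizer_exists:
  fixes \<Omega> :: "(real^'d) set" and T :: "'d distribution"
  assumes "\<Omega> \<in> lmeasurable" and "1 < p" and "\<alpha> > 0" and "\<beta> > 0" and T0: "T (\<lambda>x. 0) = 0"
  shows "\<exists>w \<in> Lp p \<Omega>.
    ereal \<alpha> * radon_norm \<Omega> (T - distr_of_fun \<Omega> w) + ereal (\<beta> * Lp_norm p \<Omega> w) =
    (INF v \<in> Lp p \<Omega>. ereal \<alpha> * radon_norm \<Omega> (T - distr_of_fun \<Omega> v) + ereal (\<beta> * Lp_norm p \<Omega> v))"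
proof -
  define F where "F v = ereal \<alpha> * radon_norm \<Omega> (T - distr_of_fun \<Omega> v)
    + ereal (\<beta> * Lp_norm p \<Omega> v)" for v
  define \<Phi> where "\<Phi> = {\<phi> \<in> test_functions \<Omega>. \<forall>x. norm (\<phi> x :: real^'d) \<le> 1}"
  have F_le: "F v \<le> ereal c \<longleftrightarrow>
      (\<forall>\<phi>\<in>\<Phi>. \<alpha> * (T \<phi> - distr_of_fun \<Omega> v \<phi>) + \<beta> * Lp_norm p \<Omega> v \<le> c)" for v c
    unfolding F_def radon_norm_plus_le_iff[OF \<open>\<alpha> > 0\<close>] \<Phi>_def by auto
  have zero: "(\<lambda>x. 0) \<in> \<Phi>" by (simp add: \<Phi>_def test_functions_zero)
  have norm_le: "\<beta> * Lp_norm p \<Omega> v \<le> c" if "F v \<le> ereal c" for v c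
    using that zero unfolding F_le by (force simp: T0 distr_of_fun_zero)
  have F_nonneg: "0 \<le> F v" for v
  proof (rule ccontr)
    assume neg: "\<not> 0 \<le> F v"
    obtain c where c: "F v \<le> ereal c" "c < 0"
    proof (cases "F v")
      case (real c)
      then show thesis using that[of c] neg by simp
    next
      case MInf
      then show thesis using that[of "- 1"] by simp
    qed (use neg in simp)
    have "0 \<le> \<beta> * Lp_norm p \<Omega> v" using Lp_norm_nonneg[of p \<Omega> v] \<open>\<beta> > 0\<close> by simp
    then show False using norm_le[OF c(1)] c(2) by linarith
  qed
  define I where "I = (INF v \<in> Lp p \<Omega>. F v)"
  have I_le: "I \<le> F v" if "v \<in> Lp p \<Omega>" for v unfolding I_def using that by (rule INF_lower)
  have I0: "0 \<le> I" unfolding I_def using F_nonneg by (intro INF_greatest)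
  have "\<exists>w \<in> Lp p \<Omega>. F w \<le> I"
  proof (cases I)
    case PInf
    \<comment> \<open>With infimum infinity every member of \<open>Lp p \<Omega>\<close> satisfies
      the inequality, and zero is such a member.\<close>
    then show ?thesis using Lp_zero by auto
  next
    case MInf
    then show ?thesis using I0 by simp
  next
    case (real r)
    have fin: "finite_measure (lebesgue_on \<Omega>)"
      using \<open>\<Omega> \<in> lmeasurable\<close> by (rule finite_measure_lebesgue_on)
    define C where "C n = {v \<in> Lp p \<Omega>. F v \<le> ereal (r + 1 / real (Suc n))}" for n
    \<comment> \<open>\<open>C 0\<close> is the sublevel set at level \<open>r + 1\<close>, so by
      \<open>norm_le\<close> its members have norm at most \<open>(r + 1) / \<beta>\<close>.\<close>
    obtain q B where q: "q > 1"
      and iq: "\<And>w :: real^'d \<Rightarrow> real^'d. w \<in> Lp p \<Omega> \<Longrightarrow> integrable (lebesgue_on \<Omega>) (\<lambda>x. norm (w x) powr q)"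
      and Bq: "\<And>w :: real^'d \<Rightarrow> real^'d. w \<in> Lp p \<Omega> \<Longrightarrow> Lp_norm p \<Omega> w \<le> (r + 1) / \<beta> \<Longrightarrow>
        (\<integral>x. norm (w x) powr q \<partial>lebesgue_on \<Omega>) \<le> B"
      using Lp_superlinear_bound[OF \<open>1 < p\<close> fin] by metis
    have iv: "integrable (lebesgue_on \<Omega>) v" if "v \<in> Lp p \<Omega>" for v :: "real^'d \<Rightarrow> real^'d"
      using integrable_of_powr_integrable[OF fin, of q v] q iq[OF that]
        Lp_borel_measurable[OF that] by simp
    have dec: "C m \<subseteq> C n" if "n \<le> m" for n m
    proof -
      have "1 / real (Suc m) \<le> 1 / real (Suc n)" using that by (simp add: frac_le)
      then have "ereal (r + 1 / real (Suc m)) \<le> ereal (r + 1 / real (Suc n))" by simp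
      then show ?thesis unfolding C_def using order_trans by blast
    qed
    have ne: "C n \<noteq> {}" for n
    proof -
      have "I < ereal (r + 1 / real (Suc n))" using real by simp
      then obtain v where "v \<in> Lp p \<Omega>" "F v < ereal (r + 1 / real (Suc n))"
        unfolding I_def INF_less_iff by blast
      then show ?thesis unfolding C_def by (auto intro: less_imp_le)
    qed
    have mid: "(\<lambda>x. (1/2) *\<^sub>R (v x + w x)) \<in> C n" if v: "v \<in> C n" and w: "w \<in> C n" for n v w
    proof -
      let ?z = "\<lambda>x. (1/2) *\<^sub>R (v x + w x)"
      have L: "v \<in> Lp p \<Omega>" "w \<in> Lp p \<Omega>" using v w by (auto simp: C_def)
      have "\<alpha> * (T \<phi> - distr_of_fun \<Omega> ?z \<phi>) + \<beta> * Lp_norm p \<Omega> ?z \<le> r + 1 / real (Suc n)"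
        if \<phi>: "\<phi> \<in> \<Phi>" for \<phi>
      proof -
        have z: "distr_of_fun \<Omega> ?z \<phi> = (distr_of_fun \<Omega> v \<phi> + distr_of_fun \<Omega> w \<phi>) / 2"
          using iv L \<phi> by (intro distr_of_fun_midpoint) (auto simp: \<Phi>_def)
        show ?thesis unfolding z
          using v w \<phi> Lp_midpoint(2)[OF \<open>1 < p\<close> L] \<open>\<beta> > 0\<close>
          by (intro midpoint_le[where x = "Lp_norm p \<Omega> v" and y = "Lp_norm p \<Omega> w"])
            (auto simp: C_def F_le)
      qed
      then show ?thesis unfolding C_def F_le using Lp_midpoint(1)[OF \<open>1 < p\<close> L] by blast
    qed
    have bd: "(\<integral>x. norm (v x) powr q \<partial>lebesgue_on \<Omega>) \<le> B" if "v \<in> C 0" for v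
      using that norm_le[of v "r + 1"] \<open>\<beta> > 0\<close>
      by (intro Bq) (auto simp: C_def field_simps)
    have C_meas: "v \<in> borel_measurable (lebesgue_on \<Omega>)"
      and C_int: "integrable (lebesgue_on \<Omega>) (\<lambda>x. norm (v x) powr q)" if "v \<in> C 0" for v
      using that Lp_borel_measurable iq by (auto simp: C_def)
    have "\<exists>v w. (\<forall>n. v n \<in> C n) \<and> integrable (lebesgue_on \<Omega>) w \<and>
        (AE x in lebesgue_on \<Omega>. (\<lambda>n. v n x) \<longlonglongrightarrow> w x) \<and>
        (\<lambda>n. \<integral>x. norm (v n x - w x) \<partial>lebesgue_on \<Omega>) \<longlonglongrightarrow> 0"
      by (rule L1_convergent_selection[of _ q C B, OF fin q dec ne C_meas C_int bd mid])
        (assumption | blast)+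
    then obtain v w where vC: "\<And>n. v n \<in> C n" and w: "integrable (lebesgue_on \<Omega>) w"
      and lim: "AE x in lebesgue_on \<Omega>. (\<lambda>n. v n x) \<longlonglongrightarrow> w x"
      and L1: "(\<lambda>n. \<integral>x. norm (v n x - w x) \<partial>lebesgue_on \<Omega>) \<longlonglongrightarrow> 0"
      by blast
    have vL: "v n \<in> Lp p \<Omega>" for n using vC[of n] by (simp add: C_def)
    have wm: "w \<in> borel_measurable (lebesgue_on \<Omega>)" using w by simp
    have conv: "(\<lambda>n. distr_of_fun \<Omega> (v n) \<phi>) \<longlonglongrightarrow> distr_of_fun \<Omega> w \<phi>" if "\<phi> \<in> \<Phi>" for \<phi>
      using iv[OF vL] w L1 that by (intro distr_of_fun_tendsto) (auto simp: \<Phi>_def)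
    \<comment> \<open>For fixed \<open>\<phi>\<close> the sublevel inequality is solved for the norm
      of \<open>v n\<close>; the resulting bound converges because the pairings do, and lower
      semicontinuity passes to \<open>w\<close>.\<close>
    have limit: "w \<in> Lp p \<Omega> \<and>
        \<alpha> * (T \<phi> - distr_of_fun \<Omega> w \<phi>) + \<beta> * Lp_norm p \<Omega> w \<le> r"
      if \<phi>: "\<phi> \<in> \<Phi>" for \<phi>
    proof -
      define c where
        "c n = (r + 1 / real (Suc n) - \<alpha> * (T \<phi> - distr_of_fun \<Omega> (v n) \<phi>)) / \<beta>" for n
      have c: "c \<longlonglongrightarrow> (r + 0 - \<alpha> * (T \<phi> - distr_of_fun \<Omega> w \<phi>)) / \<beta>"
        unfolding c_def using conv[OF \<phi>] \<open>\<beta> > 0\<close> lim_const_over_n[of 1, THEN LIMSEQ_Suc]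
        by (intro tendsto_intros) auto
      have le: "Lp_norm p \<Omega> (v n) \<le> c n" for n
      proof -
        have "\<alpha> * (T \<phi> - distr_of_fun \<Omega> (v n) \<phi>) + \<beta> * Lp_norm p \<Omega> (v n) \<le> r + 1 / real (Suc n)"
          using vC[of n] \<phi> unfolding C_def F_le by blast
        then show ?thesis using \<open>\<beta> > 0\<close> unfolding c_def by (simp add: pos_le_divide_eq algebra_simps)
      qed
      have "Lp_norm p \<Omega> w * \<beta> \<le> r + 0 - \<alpha> * (T \<phi> - distr_of_fun \<Omega> w \<phi>)"
        using Lp_norm_lower_semicontinuous(2)[OF \<open>1 < p\<close> vL wm lim le c] \<open>\<beta> > 0\<close>
        by (simp only: pos_le_divide_eq)
      moreover have "w \<in> Lp p \<Omega>"
        by (rule Lp_norm_lower_semicontinuous(1)[OF \<open>1 < p\<close> vL wm lim le c])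
      ultimately show ?thesis by (simp add: mult.commute)
    qed
    \<comment> \<open>The supremum over test functions is taken only after the limit. Membership of
      \<open>w\<close> is then read off at the zero test function.\<close>
    then have "F w \<le> I" unfolding real F_le by blast
    moreover have "w \<in> Lp p \<Omega>" using limit zero by blast
    ultimately show ?thesis by blast
  qed
  then obtain w where "w \<in> Lp p \<Omega>" "F w \<le> I" by blast
  then have "w \<in> Lp p \<Omega>" "F w = I" using I_le by (auto intro: antisym)
  then show ?thesis unfolding F_def I_def by blast
qed

theorem proposition2p1:
  fixes \<Omega> :: "(real^'d) set" and p :: ennreal and \<alpha> \<beta> :: real and u :: "real^'d \<Rightarrow> real"
  assumes "open \<Omega>" and "bounded \<Omega>" and "lipschitz_boundary \<Omega>"
    and "1 < p" and "\<alpha> > 0" and "\<beta> > 0"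
    and "u \<in> BV \<Omega>"
  shows "\<exists>w \<in> Lp p \<Omega>.
    ereal \<alpha> * radon_norm \<Omega> (distr_grad \<Omega> u - distr_of_fun \<Omega> w) + ereal (\<beta> * Lp_norm p \<Omega> w) =
    (INF v \<in> Lp p \<Omega>.
      ereal \<alpha> * radon_norm \<Omega> (distr_grad \<Omega> u - distr_of_fun \<Omega> v) + ereal (\<beta> * Lp_norm p \<Omega> v))"
  using assms
  \<comment> \<open>A bounded open set has finite Lebesgue measure, and the distributional gradient
    vanishes at the zero test function.\<close>
  by (intro radon_norm_Lp_minimizer_exists lmeasurable_open distr_grad_zero)

end
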